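(* Every cube tiling of $\mathbb{R}^{5}$ contains a column. That is, if $T\subseteq\mathbb{R}^5$ is such that the cubes $[0,1)^5+t$, $t\in T$, are pairwise disjoint (for distinct $t\in T$) and their union is $\mathbb{R}^5$, then there exist $s\in\mathbb{R}^5$ and $i\in\{1,\ldots,5\}$ such that $s+ke_i\in T$ for every $k\in\mathbb{Z}$, where $e_i$ is the $i$-th element of the standard basis of $\mathbb{R}^5$.
   Context: For $T\subseteq\mathbb{R}^n$, the family $[0,1)^n+T=\{[0,1)^n+t\colon t\in T\}$ is a cube tiling of $\mathbb{R}^n$ if for each pair of distinct $s,t\in T$ the cubes $[0,1)^n+s$ and $[0,1)^n+t$ are disjoint and $\bigcup_{t\in T}([0,1)^n+t)=\mathbb{R}^n$. No periodicity or lattice assumption is made on $T$. A column is a family of cubes of the form $\{[0,1)^n+(s+ke_i)\colon k\in\mathbb{Z}\}$, where $s\in\mathbb{R}^n$ and $e_i$ is an element of the standard basis of $\mathbb{R}^n$; a tiling contains a column if all the cubes of some column belong to the tiling. *)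

theory Defs
  imports "HOL-Analysis.Analysis"
begin

definition unit_cube :: "real ^ 'n \<Rightarrow> (real ^ 'n) set" where
  "unit_cube t = (\<lambda>x. x + t) ` {x. \<forall>i. 0 \<le> x $ i \<and> x $ i < 1}"

definition cube_tiling :: "(real ^ 'n) set \<Rightarrow> bool" where
  "cube_tiling T \<longleftrightarrow>
     (\<forall>s\<in>T. \<forall>t\<in>T. s \<noteq> t \<longrightarrow> unit_cube s \<inter> unit_cube t = {}) \<and>
     (\<Union>t\<in>T. unit_cube t) = UNIV"

end

theory Submission
  imports Defs
begin

text \<open>Every cube of a tiling of \<open>\<real>\<^sup>n\<close> contains exactly one point of the integer lattice, so the cubes are
indexed by lattice points \<open>z\<close> and the tiling is recorded by the offsets \<open>f i z \<in> [0, 1)\<close> of the cube of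
\<open>z\<close> in the coordinates \<open>i\<close>. By Keller's theorem (\<open>keller\<close>) two cubes of a tiling differ by a
nonzero integer in some coordinate; for the offsets this says that any two lattice points \<open>z \<noteq> w\<close>
have a coordinate \<open>i\<close> with \<open>z i \<noteq> w i\<close> and \<open>f i z = f i w\<close> (\<open>keller_labelling\<close>). A column is a lattice line
along which no label changes. From here on the argument is combinatorial.

Write \<open>i \<rightarrow> j\<close> at \<open>z\<close> if the label \<open>j\<close> changes somewhere on the line through \<open>z\<close> in direction \<open>i\<close>
(\<open>varies f i j z\<close>). The label \<open>i\<close> is constant along direction \<open>i\<close>, never are both \<open>i \<rightarrow> j\<close> and \<open>j \<rightarrow> i\<close> at
the same point, and the line in direction \<open>i\<close> through \<open>z\<close> is a column iff no arrow leaves \<open>i\<close> at \<open>z\<close>. If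
there were no column, then in dimension five an arrow would leave each of the five directions at
each point; following arrows one finds a directed cycle of length 3, 4 or 5.

A three-cycle \<open>i \<rightarrow> j \<rightarrow> k \<rightarrow> i\<close> at a point produces three distinguished lines, one in each of these
directions, that are constant in the labels \<open>i\<close>, \<open>j\<close>, \<open>k\<close>. None of them is a column, so each has an
arrow to one of the two remaining directions (\<open>ring_exit\<close>). Up to symmetry either all three arrows
point to the same direction or two point to one and the third to the other; both are
contradictory (\<open>no_three_cycle\<close>).

Without three-cycles, one of the three labels of any three-dimensional flat is constant on that flat
(\<open>flat_dichotomy\<close>). This makes the labels so rigid that the two remaining patterns, a four-cycle
with a fifth direction pointing to it and a five-cycle, can be refuted as well
(\<open>no_four_cycle\<close>, \<open>no_five_cycle\<close>).

Each of these four refutations is local: it involves the given point and finitely many further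
points, obtained from the fact that certain explicit lines are not columns, and compares
explicit pairs of these points. What remains is a propositional contradiction between
equalities of labels.\<close>

section \<open>Keller's theorem on the offsets of cubes\<close>

lemma unit_cube_iff: "x \<in> unit_cube t \<longleftrightarrow> (\<forall>i. t $ i \<le> x $ i \<and> x $ i < t $ i + 1)"
proof
  assume "x \<in> unit_cube t"
  then show "\<forall>i. t $ i \<le> x $ i \<and> x $ i < t $ i + 1"
    by (auto simp: unit_cube_def)
next
  assume *: "\<forall>i. t $ i \<le> x $ i \<and> x $ i < t $ i + 1"
  have "x - t \<in> {x. \<forall>i. 0 \<le> x $ i \<and> x $ i < 1}"
  proof (rule CollectI, rule allI)
    fix i show "0 \<le> (x - t) $ i \<and> (x - t) $ i < 1" using spec[OF *, of i] by simp
  qed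
  then show "x \<in> unit_cube t"
    unfolding unit_cube_def by (rule image_eqI[rotated]) simp
qed

text \<open>The cubes carry names from an index set, because the cubes are moved below: distinct names keep
their cubes apart without any injectivity argument, and moving a cube onto another one becomes
visible as a coincidence of two names.\<close>

definition tiles :: "'a set \<Rightarrow> ('a \<Rightarrow> real ^ 'n) \<Rightarrow> bool" where
  "tiles I p \<longleftrightarrow> (\<forall>x. \<exists>!a. a \<in> I \<and> x \<in> unit_cube (p a))"

lemma tiles_unique:
  "tiles I p \<Longrightarrow> a \<in> I \<Longrightarrow> b \<in> I \<Longrightarrow> x \<in> unit_cube (p a) \<Longrightarrow> x \<in> unit_cube (p b) \<Longrightarrow> a = b"
  unfolding tiles_def by blast

definition on_line :: "real ^ 'n \<Rightarrow> 'n \<Rightarrow> real ^ 'n \<Rightarrow> bool" where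
  "on_line x i t \<longleftrightarrow> (\<forall>j. j \<noteq> i \<longrightarrow> t $ j \<le> x $ j \<and> x $ j < t $ j + 1)"

definition set_coord :: "'n \<Rightarrow> real \<Rightarrow> real ^ 'n \<Rightarrow> real ^ 'n" where
  "set_coord i r x = (\<chi> j. if j = i then r else x $ j)"

lemma set_coord_in_unit_cube:
  "set_coord i r x \<in> unit_cube t \<longleftrightarrow> on_line x i t \<and> t $ i \<le> r \<and> r < t $ i + 1"
  unfolding unit_cube_iff on_line_def set_coord_def by (simp, metis)

lemma in_unit_cube_line: "x \<in> unit_cube t \<longleftrightarrow> on_line x i t \<and> t $ i \<le> x $ i \<and> x $ i < t $ i + 1"
  unfolding unit_cube_iff on_line_def by metis

text \<open>A line in direction \<open>i\<close> is partitioned by the half-open unit intervals that the cubes cut out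
of it. Hence where one interval ends the next one begins, and all their left endpoints agree modulo 1.\<close>

lemma line_successor:
  assumes "tiles I p" "a \<in> I" "on_line x i (p a)"
  shows "\<exists>b\<in>I. on_line x i (p b) \<and> p b $ i = p a $ i + real n"
proof (induction n)
  case 0 then show ?case using assms by auto
next
  case (Suc n)
  then obtain b where b: "b \<in> I" "on_line x i (p b)" "p b $ i = p a $ i + real n" by blast
  obtain c where c: "c \<in> I" "set_coord i (p b $ i + 1) x \<in> unit_cube (p c)"
    using assms(1) unfolding tiles_def by blast
  then have c': "on_line x i (p c)" "p c $ i \<le> p b $ i + 1" "p b $ i + 1 < p c $ i + 1"
    by (auto simp: set_coord_in_unit_cube)
  have "p c $ i = p b $ i + 1"
  proof (rule ccontr)
    assume "p c $ i \<noteq> p b $ i + 1"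
    then have "set_coord i (p c $ i) x \<in> unit_cube (p b)" "set_coord i (p c $ i) x \<in> unit_cube (p c)"
      using c' b by (auto simp: set_coord_in_unit_cube)
    then have "b = c" using tiles_unique[OF assms(1) b(1) c(1)] by blast
    then show False using c' by simp
  qed
  then show ?case using c c' b by (intro bexI[of _ c]) auto
qed

lemma line_integral:
  assumes "tiles I p" "a \<in> I" "b \<in> I" "on_line x i (p a)" "on_line x i (p b)"
  shows "p a $ i - p b $ i \<in> \<int>"
proof -
  have *: "p a $ i - p b $ i \<in> \<int>"
    if ab: "a \<in> I" "b \<in> I" "on_line x i (p a)" "on_line x i (p b)" "p a $ i \<le> p b $ i" for a b
  proof -
    define n where "n = nat \<lfloor>p b $ i - p a $ i\<rfloor>"
    have n: "real n \<le> p b $ i - p a $ i" "p b $ i - p a $ i < real n + 1"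
    proof -
      have "0 \<le> \<lfloor>p b $ i - p a $ i\<rfloor>" using ab(5) by simp
      then have "real n = of_int \<lfloor>p b $ i - p a $ i\<rfloor>" unfolding n_def by (rule of_nat_nat)
      then show "real n \<le> p b $ i - p a $ i" "p b $ i - p a $ i < real n + 1"
        using floor_correct[of "p b $ i - p a $ i"] by simp_all
    qed
    obtain c where c: "c \<in> I" "on_line x i (p c)" "p c $ i = p a $ i + real n"
      using line_successor[OF assms(1) ab(1,3)] by blast
    have "set_coord i (p b $ i) x \<in> unit_cube (p c)" "set_coord i (p b $ i) x \<in> unit_cube (p b)"
      using c n ab by (auto simp: set_coord_in_unit_cube)
    then have "b = c" using tiles_unique[OF assms(1) ab(2) c(1)] by blast
    then have "p a $ i - p b $ i = - of_nat n" using c by simp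
    then show ?thesis by simp
  qed
  show ?thesis
  proof (cases "p a $ i \<le> p b $ i")
    case True then show ?thesis using * assms by blast
  next
    case False
    then have "p b $ i - p a $ i \<in> \<int>" using *[of b a] assms by simp
    then show ?thesis using Ints_minus[of "p b $ i - p a $ i"] by simp
  qed
qed

text \<open>Moving all cubes of one residue class modulo 1 in coordinate \<open>i\<close> by the same amount along \<open>i\<close>
preserves the tiling: the cubes meeting a given line in direction \<open>i\<close> all belong to one class, so
that line is either left alone or translated along itself.\<close>

lemma tiles_shift:
  fixes p :: "'a \<Rightarrow> real ^ 'n" and i :: 'n and r \<alpha> :: real
  assumes "tiles I p"
  defines "q \<equiv> \<lambda>a. if p a $ i - r \<in> \<int> then p a + \<alpha> *\<^sub>R axis i 1 else p a"
  shows "tiles I q"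
  unfolding tiles_def
proof
  fix x :: "real ^ 'n"
  have line: "on_line x i (q a) \<longleftrightarrow> on_line x i (p a)" for a
    by (auto simp: on_line_def q_def axis_def)
  obtain a0 where a0: "a0 \<in> I" "x \<in> unit_cube (p a0)" using assms(1) unfolding tiles_def by blast
  then have l0: "on_line x i (p a0)" by (simp add: in_unit_cube_line[of x _ i])
  define \<beta> where "\<beta> = (if p a0 $ i - r \<in> \<int> then \<alpha> else 0)"
  have same: "q a $ i = p a $ i + \<beta>" if "a \<in> I" "on_line x i (p a)" for a
  proof -
    have "p a $ i - p a0 $ i \<in> \<int>" using line_integral[OF assms(1) that(1) a0(1) that(2) l0] .
    from Ints_add[OF this, of "p a0 $ i - r"] Ints_diff[OF _ this, of "p a $ i - r"]
    have "p a $ i - r \<in> \<int> \<longleftrightarrow> p a0 $ i - r \<in> \<int>" by auto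
    then show ?thesis by (simp add: q_def \<beta>_def axis_def)
  qed
  have "a \<in> I \<and> x \<in> unit_cube (q a) \<longleftrightarrow> a \<in> I \<and> set_coord i (x $ i - \<beta>) x \<in> unit_cube (p a)" for a
    using same[of a] by (auto simp: in_unit_cube_line[of x _ i] set_coord_in_unit_cube line)
  then show "\<exists>!a. a \<in> I \<and> x \<in> unit_cube (q a)"
    using assms(1) unfolding tiles_def by simp
qed

text \<open>If no coordinate difference were a nonzero integer, then shifting the class of \<open>a\<close> in one coordinate
after the other would move \<open>a\<close> onto \<open>b\<close> without moving \<open>b\<close>, and the cubes of a tiling never coincide.\<close>

lemma keller:
  assumes "tiles I p" "a \<in> I" "b \<in> I" "a \<noteq> b"
  shows "\<exists>i. p a $ i \<noteq> p b $ i \<and> p a $ i - p b $ i \<in> \<int>"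
proof (rule ccontr)
  assume no: "\<not> ?thesis"
  have "\<exists>q. tiles I q \<and> (\<forall>i. q a $ i = (if i \<in> S then p b $ i else p a $ i)) \<and> q b = p b" if "finite S" for S
    using that
  proof (induction S)
    case empty then show ?case using assms(1) by auto
  next
    case (insert k S)
    then obtain q where q: "tiles I q" "\<And>i. q a $ i = (if i \<in> S then p b $ i else p a $ i)" "q b = p b" by blast
    show ?case
    proof (cases "p a $ k = p b $ k")
      case True then show ?thesis using q by (intro exI[of _ q]) auto
    next
      case False
      define q' where "q' = (\<lambda>c. if q c $ k - p a $ k \<in> \<int> then q c + (p b $ k - p a $ k) *\<^sub>R axis k 1 else q c)"
      have "tiles I q'" unfolding q'_def using tiles_shift[OF q(1)] .
      moreover have "p b $ k - p a $ k \<notin> \<int>"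
        using no False Ints_minus[of "p b $ k - p a $ k"] by auto
      then have "q' b = p b" using q by (simp add: q'_def)
      moreover have "q' a $ i = (if i \<in> insert k S then p b $ i else p a $ i)" for i
        using q(2) insert.hyps by (auto simp: q'_def axis_def)
      ultimately show ?thesis by blast
    qed
  qed
  from this[of UNIV] obtain q where q: "tiles I q" "\<And>i. q a $ i = p b $ i" "q b = p b" by auto
  then have "q a = q b" by (simp add: vec_eq_iff)
  moreover have "q a \<in> unit_cube (q a)" by (simp add: unit_cube_iff)
  ultimately have "a = b" using tiles_unique[OF q(1) assms(2,3)] by metis
  then show False using assms(4) by simp
qed

text \<open>The offsets of the cubes of a tiling relative to the lattice points they contain, reduced
to their combinatorial content: only equality of labels matters, so labels have an arbitrary type.\<close>

definition keller_labelling :: "('i \<Rightarrow> ('i \<Rightarrow> int) \<Rightarrow> 'c) \<Rightarrow> bool" where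
  "keller_labelling f \<longleftrightarrow> (\<forall>z w. z \<noteq> w \<longrightarrow> (\<exists>i. z i \<noteq> w i \<and> f i z = f i w))"

lemma labelling_of_cube_tiling:
  fixes T :: "(real ^ 'n) set"
  assumes "cube_tiling T"
  obtains f :: "'n \<Rightarrow> ('n \<Rightarrow> int) \<Rightarrow> real"
  where "keller_labelling f" and "\<And>z. (\<chi> i. of_int (z i) - f i z) \<in> T"
proof -
  have tT: "tiles T (\<lambda>t. t)"
    unfolding tiles_def
  proof
    fix x
    obtain t where "t \<in> T" "x \<in> unit_cube t"
      using assms unfolding cube_tiling_def by blast
    then show "\<exists>!a. a \<in> T \<and> x \<in> unit_cube a"
      using assms unfolding cube_tiling_def by blast
  qed
  define pt :: "('n \<Rightarrow> int) \<Rightarrow> real ^ 'n" where "pt z = (\<chi> i. of_int (z i))" for z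
  define t where "t z = (THE a. a \<in> T \<and> pt z \<in> unit_cube a)" for z
  have t: "t z \<in> T" "pt z \<in> unit_cube (t z)" for z
    using theI'[of "\<lambda>a. a \<in> T \<and> pt z \<in> unit_cube a"] tT unfolding tiles_def t_def by auto
  define f where "f i z = of_int (z i) - t z $ i" for i z
  have f: "0 \<le> f i z" "f i z < 1" for i z
    using t(2)[of z] by (auto simp: unit_cube_iff pt_def f_def algebra_simps)
  have "\<exists>i. z i \<noteq> w i \<and> f i z = f i w" if "z \<noteq> w" for z w
  proof -
    have "t z \<noteq> t w"
    proof
      assume eq: "t z = t w"
      have "z i = w i" for i
      proof -
        have "of_int (z i) - of_int (w i) = f i z - f i w" by (simp add: f_def eq)
        then have "\<bar>real_of_int (z i - w i)\<bar> < 1" using f[of i z] f[of i w] by auto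
        then show ?thesis by linarith
      qed
      then show False using that by blast
    qed
    then obtain i where i: "t z $ i \<noteq> t w $ i" "t z $ i - t w $ i \<in> \<int>"
      using keller[OF tT t(1) t(1)] by blast
    then obtain m where m: "t z $ i - t w $ i = of_int m" by (auto elim: Ints_cases)
    then have "of_int (z i - w i - m) = f i z - f i w" by (simp add: f_def)
    moreover have "\<bar>f i z - f i w\<bar> < 1" using f[of i z] f[of i w] by auto
    ultimately have "z i - w i - m = 0" by linarith
    then have "f i z = f i w" using m by (simp add: f_def)
    moreover have "z i \<noteq> w i" using i(1) \<open>f i z = f i w\<close> by (auto simp: f_def)
    ultimately show ?thesis by blast
  qed
  then have "keller_labelling f" unfolding keller_labelling_def by blast
  moreover have "(\<chi> i. of_int (z i) - f i z) \<in> T" for z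
  proof -
    have "(\<chi> i. of_int (z i) - f i z) = t z" by (simp add: f_def vec_eq_iff)
    then show ?thesis using t(1)[of z] by simp
  qed
  ultimately show ?thesis by (rule that)
qed

lemma column_of_constant_line:
  fixes T :: "(real ^ 'n) set" and f :: "'n \<Rightarrow> ('n \<Rightarrow> int) \<Rightarrow> real"
  assumes "\<And>z. (\<chi> i. of_int (z i) - f i z) \<in> T"
    and const: "\<And>j k. f j (z(i := k)) = f j z"
  shows "\<exists>s i. \<forall>k::int. s + of_int k *\<^sub>R axis i 1 \<in> T"
proof -
  define s :: "real ^ 'n" where "s = (\<chi> j. of_int ((z(i := 0)) j) - f j z)"
  have "s + of_int k *\<^sub>R axis i 1 = (\<chi> j. of_int ((z(i := k)) j) - f j (z(i := k)))" for k
    by (auto simp: s_def vec_eq_iff axis_def const)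
  then have "s + of_int k *\<^sub>R axis i 1 \<in> T" for k
    using assms(1)[of "z(i := k)"] by simp
  then show ?thesis by blast
qed
section \<open>Labellings and the direction graph\<close>

text \<open>The arrow \<open>i \<rightarrow> j\<close> at \<open>z\<close>.\<close>

definition varies :: "('i \<Rightarrow> ('i \<Rightarrow> int) \<Rightarrow> 'c) \<Rightarrow> 'i \<Rightarrow> 'i \<Rightarrow> ('i \<Rightarrow> int) \<Rightarrow> bool" where
  "varies f i j z \<longleftrightarrow> (\<exists>k. f j (z(i := k)) \<noteq> f j z)"

text \<open>Two points that differ in one coordinate only can be separated by that coordinate alone.\<close>

lemma label_own_coordinate:
  assumes "keller_labelling f"
  shows "f i (z(i := k)) = f i z"
proof (cases "z(i := k) = z")
  case False
  then obtain j where "(z(i := k)) j \<noteq> z j" "f j (z(i := k)) = f j z"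
    using assms unfolding keller_labelling_def by blast
  then show ?thesis by (cases "j = i") auto
qed simp

lemma varies_irrefl: "keller_labelling f \<Longrightarrow> \<not> varies f i i z"
  by (simp add: varies_def label_own_coordinate)

text \<open>Otherwise moving along \<open>i\<close> and moving along \<open>j\<close> lead to two points that neither \<open>i\<close> nor \<open>j\<close> separates.\<close>

lemma varies_asym:
  assumes "keller_labelling f" "varies f i j z"
  shows "\<not> varies f j i z"
proof
  assume "varies f j i z"
  then obtain l where l: "f i (z(j := l)) \<noteq> f i z" by (auto simp: varies_def)
  obtain k where k: "f j (z(i := k)) \<noteq> f j z" using assms(2) by (auto simp: varies_def)
  have "i \<noteq> j" using assms varies_irrefl by metis
  have "z(i := k) \<noteq> z(j := l)"
    using k l \<open>i \<noteq> j\<close> by (metis fun_upd_other fun_upd_triv fun_upd_upd fun_upd_same)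
  then obtain m where m: "(z(i := k)) m \<noteq> (z(j := l)) m" "f m (z(i := k)) = f m (z(j := l))"
    using assms(1) unfolding keller_labelling_def by blast
  then have "m = i \<or> m = j" by (auto split: if_splits)
  then show False
    using m(2) k l label_own_coordinate[OF assms(1)] by metis
qed

text \<open>On a three-dimensional flat the arrows between directions 1 and 2 depend on the third coordinate
only, those between 1 and 3 on the second and those between 2 and 3 on the first. These can be chosen
independently, so a three-cycle exists as soon as each of its arrows occurs somewhere. A label that is
not constant and has incoming arrows from one direction only is a function of that single coordinate;
hence this arrow is present everywhere on the flat and, by asymmetry, the opposite arrow nowhere. So
either all six arrows occur, or an arrow is missing and going round the flat leaves every label with a
single incoming arrow; in both cases there is a three-cycle.\<close>

lemma three_cycle_of_nonconstant:
  fixes G1 :: "'y \<Rightarrow> 'z \<Rightarrow> 'c" and G2 :: "'x \<Rightarrow> 'z \<Rightarrow> 'c" and G3 :: "'x \<Rightarrow> 'y \<Rightarrow> 'c"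
  assumes x12: "\<And>a a' b b' c. G2 a c \<noteq> G2 a' c \<Longrightarrow> G1 b c = G1 b' c"
    and x13: "\<And>a a' b c c'. G3 a b \<noteq> G3 a' b \<Longrightarrow> G1 b c = G1 b c'"
    and x23: "\<And>a b b' c c'. G3 a b \<noteq> G3 a b' \<Longrightarrow> G2 a c = G2 a c'"
    and n1: "\<exists>b b' c c'. G1 b c \<noteq> G1 b' c'"
    and n2: "\<exists>a a' c c'. G2 a c \<noteq> G2 a' c'"
    and n3: "\<exists>a a' b b'. G3 a b \<noteq> G3 a' b'"
  shows "\<exists>a a' b b' c c'. G2 a' c \<noteq> G2 a c \<and> G3 a b' \<noteq> G3 a b \<and> G1 b c' \<noteq> G1 b c
      \<or> G1 b' c \<noteq> G1 b c \<and> G3 a' b \<noteq> G3 a b \<and> G2 a c' \<noteq> G2 a c"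
proof (rule ccontr)
  assume no: "\<not> ?thesis"
  define e12 e21 where "e12 = (\<exists>c. \<forall>a. \<exists>a'. G2 a' c \<noteq> G2 a c)"
    and "e21 = (\<exists>c. \<forall>b. \<exists>b'. G1 b' c \<noteq> G1 b c)"
  define e23 e32 where "e23 = (\<exists>a. \<forall>b. \<exists>b'. G3 a b' \<noteq> G3 a b)"
    and "e32 = (\<exists>a. \<forall>c. \<exists>c'. G2 a c' \<noteq> G2 a c)"
  define e31 e13 where "e31 = (\<exists>b. \<forall>c. \<exists>c'. G1 b c' \<noteq> G1 b c)"
    and "e13 = (\<exists>b. \<forall>a. \<exists>a'. G3 a' b \<noteq> G3 a b)"
  note e = e12_def e21_def e23_def e32_def e31_def e13_def
  have "\<not> (e12 \<and> e23 \<and> e31)" using no unfolding e by blast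
  moreover have "\<not> (e21 \<and> e13 \<and> e32)" using no unfolding e by blast
  moreover have "e21 \<or> e31" using n1 unfolding e by metis
  moreover have "e12 \<or> e32" using n2 unfolding e by metis
  moreover have "e13 \<or> e23" using n3 unfolding e by metis
  \<comment> \<open>A label with a single incoming direction depends on that coordinate alone.\<close>
  moreover have "e31 \<or> \<not> e21 \<or> \<not> e12" using x12 unfolding e by metis
  moreover have "e21 \<or> \<not> e31 \<or> \<not> e13" using x13 unfolding e by metis
  moreover have "e32 \<or> \<not> e12 \<or> \<not> e21" using x12 unfolding e by metis
  moreover have "e12 \<or> \<not> e32 \<or> \<not> e23" using x23 unfolding e by metis
  moreover have "e23 \<or> \<not> e13 \<or> \<not> e31" using x13 unfolding e by metis
  moreover have "e13 \<or> \<not> e23 \<or> \<not> e32" using x23 unfolding e by metis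
  ultimately show False by blast
qed

text \<open>Without three-cycles, three-dimensional flats are rigid.\<close>

lemma flat_dichotomy:
  assumes "keller_labelling f" "distinct [i, j, k]"
    and acyclic: "\<And>z i j k. \<lbrakk>varies f i j z; varies f j k z\<rbrakk> \<Longrightarrow> \<not> varies f k i z"
  shows "(\<forall>p q p' q'. f i (z(j := p, k := q)) = f i (z(j := p', k := q')))
    \<or> (\<forall>p q p' q'. f j (z(i := p, k := q)) = f j (z(i := p', k := q')))
    \<or> (\<forall>p q p' q'. f k (z(i := p, j := q)) = f k (z(i := p', j := q')))"
proof (rule ccontr)
  assume nonconst: "\<not> ?thesis"
  define Q where "Q a b c = z(i := a, j := b, k := c)" for a b c
  define G1 where "G1 b c = f i (z(j := b, k := c))" for b c
  define G2 where "G2 a c = f j (z(i := a, k := c))" for a c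
  define G3 where "G3 a b = f k (z(i := a, j := b))" for a b
  have Q: "(Q a b c)(i := a') = Q a' b c" "(Q a b c)(j := b') = Q a b' c" "(Q a b c)(k := c') = Q a b c'"
    for a b c a' b' c'
    using assms(2) by (auto simp: Q_def fun_eq_iff)
  have G: "f i (Q a b c) = G1 b c" "f j (Q a b c) = G2 a c" "f k (Q a b c) = G3 a b" for a b c
  proof -
    have "Q a b c = z(j := b, k := c, i := a)" "Q a b c = z(i := a, k := c, j := b)"
      "Q a b c = z(i := a, j := b, k := c)"
      using assms(2) by (auto simp: Q_def fun_eq_iff)
    then show "f i (Q a b c) = G1 b c" "f j (Q a b c) = G2 a c" "f k (Q a b c) = G3 a b"
      unfolding G1_def G2_def G3_def using label_own_coordinate[OF assms(1)] by metis+
  qed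
  have v: "varies f i j (Q a b c) \<longleftrightarrow> (\<exists>a'. G2 a' c \<noteq> G2 a c)"
      "varies f j i (Q a b c) \<longleftrightarrow> (\<exists>b'. G1 b' c \<noteq> G1 b c)"
      "varies f i k (Q a b c) \<longleftrightarrow> (\<exists>a'. G3 a' b \<noteq> G3 a b)"
      "varies f k i (Q a b c) \<longleftrightarrow> (\<exists>c'. G1 b c' \<noteq> G1 b c)"
      "varies f j k (Q a b c) \<longleftrightarrow> (\<exists>b'. G3 a b' \<noteq> G3 a b)"
      "varies f k j (Q a b c) \<longleftrightarrow> (\<exists>c'. G2 a c' \<noteq> G2 a c)" for a b c
    unfolding varies_def Q G by blast+
  have "\<exists>a a' b b' c c'. G2 a' c \<noteq> G2 a c \<and> G3 a b' \<noteq> G3 a b \<and> G1 b c' \<noteq> G1 b c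
      \<or> G1 b' c \<noteq> G1 b c \<and> G3 a' b \<noteq> G3 a b \<and> G2 a c' \<noteq> G2 a c"
  proof (rule three_cycle_of_nonconstant)
    show "G1 b c = G1 b' c" if "G2 a c \<noteq> G2 a' c" for a a' b b' c
      using varies_asym[OF assms(1), of i j "Q a b c"] that unfolding v by metis
    show "G1 b c = G1 b c'" if "G3 a b \<noteq> G3 a' b" for a a' b c c'
      using varies_asym[OF assms(1), of i k "Q a b c"] that unfolding v by metis
    show "G2 a c = G2 a c'" if "G3 a b \<noteq> G3 a b'" for a b b' c c'
      using varies_asym[OF assms(1), of j k "Q a b c"] that unfolding v by metis
    show "\<exists>b b' c c'. G1 b c \<noteq> G1 b' c'" using nonconst unfolding G1_def by blast
    show "\<exists>a a' c c'. G2 a c \<noteq> G2 a' c'" using nonconst unfolding G2_def by blast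
    show "\<exists>a a' b b'. G3 a b \<noteq> G3 a' b'" using nonconst unfolding G3_def by blast
  qed
  then obtain a b c where "varies f i j (Q a b c) \<and> varies f j k (Q a b c) \<and> varies f k i (Q a b c)
      \<or> varies f j i (Q a b c) \<and> varies f i k (Q a b c) \<and> varies f k j (Q a b c)"
    unfolding v by blast
  then show False using acyclic by blast
qed

text \<open>A numbering of the five directions. Since there are no others, the points are quintuples and the
label in a direction is a function of the other four coordinates. All arguments that depend on a chosen
pattern of arrows are carried out in a frame in which the pattern has a standard position.\<close>

locale frame =
  fixes f :: "'i \<Rightarrow> ('i \<Rightarrow> int) \<Rightarrow> 'c" and i1 i2 i3 i4 i5 :: 'i
  assumes labelling: "keller_labelling f"
    and distinct: "distinct [i1, i2, i3, i4, i5]"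
    and univ: "UNIV = {i1, i2, i3, i4, i5}"
begin

definition P :: "int \<Rightarrow> int \<Rightarrow> int \<Rightarrow> int \<Rightarrow> int \<Rightarrow> 'i \<Rightarrow> int" where
  "P a b c d e = (\<lambda>_. 0)(i1 := a, i2 := b, i3 := c, i4 := d, i5 := e)"

text \<open>The coordinate set to 0 is the one on which the label does not depend.\<close>

definition F1 :: "int \<Rightarrow> int \<Rightarrow> int \<Rightarrow> int \<Rightarrow> 'c" where "F1 b c d e = f i1 (P 0 b c d e)"
definition F2 :: "int \<Rightarrow> int \<Rightarrow> int \<Rightarrow> int \<Rightarrow> 'c" where "F2 a c d e = f i2 (P a 0 c d e)"
definition F3 :: "int \<Rightarrow> int \<Rightarrow> int \<Rightarrow> int \<Rightarrow> 'c" where "F3 a b d e = f i3 (P a b 0 d e)"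
definition F4 :: "int \<Rightarrow> int \<Rightarrow> int \<Rightarrow> int \<Rightarrow> 'c" where "F4 a b c e = f i4 (P a b c 0 e)"
definition F5 :: "int \<Rightarrow> int \<Rightarrow> int \<Rightarrow> int \<Rightarrow> 'c" where "F5 a b c d = f i5 (P a b c d 0)"

lemma P_upd:
  "(P a b c d e)(i1 := k) = P k b c d e" "(P a b c d e)(i2 := k) = P a k c d e"
  "(P a b c d e)(i3 := k) = P a b k d e" "(P a b c d e)(i4 := k) = P a b c k e"
  "(P a b c d e)(i5 := k) = P a b c d k"
  using distinct by (auto simp: P_def fun_eq_iff)

lemma P_app:
  "P a b c d e i1 = a" "P a b c d e i2 = b" "P a b c d e i3 = c" "P a b c d e i4 = d" "P a b c d e i5 = e"
  using distinct by (auto simp: P_def)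

lemma f_P:
  "f i1 (P a b c d e) = F1 b c d e" "f i2 (P a b c d e) = F2 a c d e"
  "f i3 (P a b c d e) = F3 a b d e" "f i4 (P a b c d e) = F4 a b c e"
  "f i5 (P a b c d e) = F5 a b c d"
  unfolding F1_def F2_def F3_def F4_def F5_def
  using label_own_coordinate[OF labelling, symmetric] P_upd by metis+

lemma P_of: "z = P (z i1) (z i2) (z i3) (z i4) (z i5)"
proof
  fix i
  have "i \<in> {i1, i2, i3, i4, i5}" using univ by blast
  then show "z i = P (z i1) (z i2) (z i3) (z i4) (z i5) i" by (auto simp: P_app)
qed

lemma sep:
  "(a, b, c, d, e) = (a', b', c', d', e')
    \<or> a \<noteq> a' \<and> F1 b c d e = F1 b' c' d' e' \<or> b \<noteq> b' \<and> F2 a c d e = F2 a' c' d' e'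
    \<or> c \<noteq> c' \<and> F3 a b d e = F3 a' b' d' e' \<or> d \<noteq> d' \<and> F4 a b c e = F4 a' b' c' e'
    \<or> e \<noteq> e' \<and> F5 a b c d = F5 a' b' c' d'"
proof (cases "P a b c d e = P a' b' c' d' e'")
  case True
  then show ?thesis by (metis P_app)
next
  case False
  then obtain i where i: "P a b c d e i \<noteq> P a' b' c' d' e' i" "f i (P a b c d e) = f i (P a' b' c' d' e')"
    using labelling unfolding keller_labelling_def by blast
  have "i \<in> {i1, i2, i3, i4, i5}" using univ by blast
  then show ?thesis using i by (auto simp: P_app f_P)
qed

lemma varies_P:
  "varies f i1 j (P a b c d e) \<longleftrightarrow> (\<exists>k. f j (P k b c d e) \<noteq> f j (P a b c d e))"
  "varies f i2 j (P a b c d e) \<longleftrightarrow> (\<exists>k. f j (P a k c d e) \<noteq> f j (P a b c d e))"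
  "varies f i3 j (P a b c d e) \<longleftrightarrow> (\<exists>k. f j (P a b k d e) \<noteq> f j (P a b c d e))"
  "varies f i4 j (P a b c d e) \<longleftrightarrow> (\<exists>k. f j (P a b c k e) \<noteq> f j (P a b c d e))"
  "varies f i5 j (P a b c d e) \<longleftrightarrow> (\<exists>k. f j (P a b c d k) \<noteq> f j (P a b c d e))"
  unfolding varies_def P_upd by simp_all

end

locale columnless = frame +
  assumes columnless: "\<And>z i. \<exists>j. varies f i j z"
begin

lemma no_column:
  "\<exists>k. F2 k c d e \<noteq> F2 a c d e \<or> F3 k b d e \<noteq> F3 a b d e \<or> F4 k b c e \<noteq> F4 a b c e \<or> F5 k b c d \<noteq> F5 a b c d"
  "\<exists>k. F1 k c d e \<noteq> F1 b c d e \<or> F3 a k d e \<noteq> F3 a b d e \<or> F4 a k c e \<noteq> F4 a b c e \<or> F5 a k c d \<noteq> F5 a b c d"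
  "\<exists>k. F1 b k d e \<noteq> F1 b c d e \<or> F2 a k d e \<noteq> F2 a c d e \<or> F4 a b k e \<noteq> F4 a b c e \<or> F5 a b k d \<noteq> F5 a b c d"
  "\<exists>k. F1 b c k e \<noteq> F1 b c d e \<or> F2 a c k e \<noteq> F2 a c d e \<or> F3 a b k e \<noteq> F3 a b d e \<or> F5 a b c k \<noteq> F5 a b c d"
  "\<exists>k. F1 b c d k \<noteq> F1 b c d e \<or> F2 a c d k \<noteq> F2 a c d e \<or> F3 a b d k \<noteq> F3 a b d e \<or> F4 a b c k \<noteq> F4 a b c e"
proof -
  have j: "j \<in> {i1, i2, i3, i4, i5}" for j using univ by blast
  obtain j1 where "varies f i1 j1 (P a b c d e)" using columnless by blast
  then show "\<exists>k. F2 k c d e \<noteq> F2 a c d e \<or> F3 k b d e \<noteq> F3 a b d e \<or> F4 k b c e \<noteq> F4 a b c e \<or> F5 k b c d \<noteq> F5 a b c d"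
    using j[of j1] unfolding varies_P by (auto simp: f_P)
  obtain j2 where "varies f i2 j2 (P a b c d e)" using columnless by blast
  then show "\<exists>k. F1 k c d e \<noteq> F1 b c d e \<or> F3 a k d e \<noteq> F3 a b d e \<or> F4 a k c e \<noteq> F4 a b c e \<or> F5 a k c d \<noteq> F5 a b c d"
    using j[of j2] unfolding varies_P by (auto simp: f_P)
  obtain j3 where "varies f i3 j3 (P a b c d e)" using columnless by blast
  then show "\<exists>k. F1 b k d e \<noteq> F1 b c d e \<or> F2 a k d e \<noteq> F2 a c d e \<or> F4 a b k e \<noteq> F4 a b c e \<or> F5 a b k d \<noteq> F5 a b c d"
    using j[of j3] unfolding varies_P by (auto simp: f_P)
  obtain j4 where "varies f i4 j4 (P a b c d e)" using columnless by blast
  then show "\<exists>k. F1 b c k e \<noteq> F1 b c d e \<or> F2 a c k e \<noteq> F2 a c d e \<or> F3 a b k e \<noteq> F3 a b d e \<or> F5 a b c k \<noteq> F5 a b c d"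
    using j[of j4] unfolding varies_P by (auto simp: f_P)
  obtain j5 where "varies f i5 j5 (P a b c d e)" using columnless by blast
  then show "\<exists>k. F1 b c d k \<noteq> F1 b c d e \<or> F2 a c d k \<noteq> F2 a c d e \<or> F3 a b d k \<noteq> F3 a b d e \<or> F4 a b c k \<noteq> F4 a b c e"
    using j[of j5] unfolding varies_P by (auto simp: f_P)
qed

end
section \<open>Three-cycles\<close>

context columnless
begin

text \<open>
The cycle is \<open>1 \<rightarrow> 2 \<rightarrow> 3 \<rightarrow> 1\<close> at \<open>(a0, b0, c0, d0, e0)\<close>. The ring lines are the line in direction 1 at
\<open>(b0, c1)\<close>, in direction 2 at \<open>(a1, c0)\<close> and in direction 3 at \<open>(a0, b1)\<close>; here label 4 changes on all of them.
Move a ring line to another level of direction 4. A point at the new level that none of the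
directions 1, 2, 3 separates from points of the old line has the same label 4 as those points; so it
cannot be unseparated from two points with different labels 4. Played off against all three
ring lines this prevents direction 4 from changing the labels 1, 2, 3 at a ring point, so
\<open>4 \<rightarrow> 5\<close> there. Knowing this, the same comparison between other levels of direction 4 and other
levels of direction 5 shows that direction 5 does not change the labels 1, 2, 3 on a ring line either.
It cannot change label 4, because \<open>4 \<rightarrow> 5\<close>, and so there would be a column in direction 5.
\<close>

lemma no_three_cycle_with_common_exit:
  assumes edges: "F1 b0 c1 d0 e0 \<noteq> F1 b0 c0 d0 e0" "F2 a1 c0 d0 e0 \<noteq> F2 a0 c0 d0 e0"
    "F3 a0 b1 d0 e0 \<noteq> F3 a0 b0 d0 e0" "F4 a1 b2 c0 e0 \<noteq> F4 a1 b0 c0 e0"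
    "F4 a0 b1 c2 e0 \<noteq> F4 a0 b1 c0 e0" "F4 a2 b0 c1 e0 \<noteq> F4 a0 b0 c1 e0"
  shows False
proof -
  obtain d1 where w1: "F1 b0 c1 d1 e0 \<noteq> F1 b0 c1 d0 e0 \<or> F2 a0 c1 d1 e0 \<noteq> F2 a0 c1 d0 e0
      \<or> F3 a0 b0 d1 e0 \<noteq> F3 a0 b0 d0 e0 \<or> F5 a0 b0 c1 d1 \<noteq> F5 a0 b0 c1 d0"
    using no_column(4) by blast
  obtain d2 where w2: "F1 b1 c0 d2 e0 \<noteq> F1 b1 c0 d0 e0 \<or> F2 a0 c0 d2 e0 \<noteq> F2 a0 c0 d0 e0
      \<or> F3 a0 b1 d2 e0 \<noteq> F3 a0 b1 d0 e0 \<or> F5 a0 b1 c0 d2 \<noteq> F5 a0 b1 c0 d0"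
    using no_column(4) by blast
  obtain d3 where w3: "F1 b1 c2 d3 e0 \<noteq> F1 b1 c2 d0 e0 \<or> F2 a0 c2 d3 e0 \<noteq> F2 a0 c2 d0 e0
      \<or> F3 a0 b1 d3 e0 \<noteq> F3 a0 b1 d0 e0 \<or> F5 a0 b1 c2 d3 \<noteq> F5 a0 b1 c2 d0"
    using no_column(4) by blast
  obtain d4 where w4: "F1 b0 c0 d4 e0 \<noteq> F1 b0 c0 d0 e0 \<or> F2 a1 c0 d4 e0 \<noteq> F2 a1 c0 d0 e0
      \<or> F3 a1 b0 d4 e0 \<noteq> F3 a1 b0 d0 e0 \<or> F5 a1 b0 c0 d4 \<noteq> F5 a1 b0 c0 d0"
    using no_column(4) by blast
  obtain d5 where w5: "F1 b0 c1 d5 e0 \<noteq> F1 b0 c1 d0 e0 \<or> F2 a2 c1 d5 e0 \<noteq> F2 a2 c1 d0 e0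
      \<or> F3 a2 b0 d5 e0 \<noteq> F3 a2 b0 d0 e0 \<or> F5 a2 b0 c1 d5 \<noteq> F5 a2 b0 c1 d0"
    using no_column(4) by blast
  obtain e1 where w6: "F1 b0 c1 d0 e1 \<noteq> F1 b0 c1 d0 e0 \<or> F2 a0 c1 d0 e1 \<noteq> F2 a0 c1 d0 e0
      \<or> F3 a0 b0 d0 e1 \<noteq> F3 a0 b0 d0 e0 \<or> F4 a0 b0 c1 e1 \<noteq> F4 a0 b0 c1 e0"
    using no_column(5) by blast
  obtain e2 where w7: "F1 b0 c1 d0 e2 \<noteq> F1 b0 c1 d0 e0 \<or> F2 a2 c1 d0 e2 \<noteq> F2 a2 c1 d0 e0
      \<or> F3 a2 b0 d0 e2 \<noteq> F3 a2 b0 d0 e0 \<or> F4 a2 b0 c1 e2 \<noteq> F4 a2 b0 c1 e0"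
    using no_column(5) by blast
  \<comment> \<open>The levels \<open>a2\<close>, \<open>b2\<close>, \<open>c2\<close> give a second point on each ring line, and the lines in directions 4
    and 5 considered above pass through ring points; it remains to compare pairs of points.\<close>
  show False
    using edges w1 w2 w3 w4 w5 w6 w7
      sep[of a0 b0 c0 d0 e0 a0 b1 c2 d0 e0] sep[of a0 b0 c0 d0 e0 a0 b1 c2 d1 e0]
      sep[of a0 b0 c0 d0 e0 a1 b0 c1 d0 e0] sep[of a0 b0 c0 d0 e0 a1 b1 c0 d0 e0]
      sep[of a0 b0 c0 d1 e0 a0 b0 c1 d0 e0] sep[of a0 b0 c0 d1 e0 a0 b0 c2 d0 e0]
      sep[of a0 b0 c0 d1 e0 a0 b1 c0 d0 e0] sep[of a0 b0 c0 d1 e0 a2 b0 c1 d0 e0]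
      sep[of a0 b0 c0 d3 e0 a0 b1 c2 d3 e0] sep[of a0 b0 c0 d3 e0 a1 b0 c1 d3 e0]
      sep[of a0 b0 c0 d3 e0 a2 b0 c1 d3 e0] sep[of a0 b0 c0 d5 e0 a2 b2 c0 d5 e0]
      sep[of a0 b0 c1 d0 e0 a0 b1 c0 d2 e0] sep[of a0 b0 c1 d0 e0 a0 b1 c0 d3 e0]
      sep[of a0 b0 c1 d0 e0 a0 b1 c0 d4 e0] sep[of a0 b0 c1 d0 e0 a0 b1 c0 d5 e0]
      sep[of a0 b0 c1 d0 e0 a0 b1 c2 d3 e0] sep[of a0 b0 c1 d0 e0 a1 b0 c0 d4 e0]
      sep[of a0 b0 c1 d0 e0 a1 b0 c1 d0 e1] sep[of a0 b0 c1 d0 e0 a1 b0 c1 d0 e2]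
      sep[of a0 b0 c1 d0 e0 a1 b2 c0 d0 e0] sep[of a0 b0 c1 d0 e0 a2 b0 c1 d1 e0]
      sep[of a0 b0 c1 d0 e0 a2 b0 c1 d5 e0] sep[of a0 b0 c1 d0 e1 a0 b1 c0 d0 e0]
      sep[of a0 b0 c1 d0 e1 a0 b1 c0 d2 e0] sep[of a0 b0 c1 d0 e1 a0 b1 c2 d0 e0]
      sep[of a0 b0 c1 d0 e1 a0 b1 c2 d3 e0] sep[of a0 b0 c1 d0 e1 a1 b0 c0 d0 e0]
      sep[of a0 b0 c1 d0 e1 a1 b0 c0 d4 e0] sep[of a0 b0 c1 d0 e1 a2 b0 c1 d5 e0]
      sep[of a0 b0 c1 d0 e2 a2 b0 c1 d5 e0] sep[of a0 b0 c1 d1 e0 a0 b0 c1 d0 e1]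
      sep[of a0 b0 c1 d1 e0 a0 b0 c1 d0 e2] sep[of a0 b0 c1 d1 e0 a0 b1 c0 d2 e0]
      sep[of a0 b0 c1 d1 e0 a0 b1 c2 d0 e0] sep[of a0 b0 c1 d1 e0 a1 b0 c0 d0 e0]
      sep[of a0 b0 c1 d1 e0 a2 b0 c1 d4 e0] sep[of a0 b0 c1 d3 e0 a1 b0 c0 d0 e0]
      sep[of a0 b0 c1 d3 e0 a2 b0 c1 d5 e0] sep[of a0 b0 c1 d4 e0 a1 b0 c0 d4 e0]
      sep[of a0 b0 c1 d4 e0 a2 b0 c0 d4 e0] sep[of a0 b0 c1 d5 e0 a1 b0 c0 d0 e0]
      sep[of a0 b0 c1 d5 e0 a2 b0 c0 d5 e0] sep[of a0 b0 c2 d0 e0 a0 b1 c1 d0 e0]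
      sep[of a0 b0 c2 d1 e0 a0 b1 c0 d1 e0] sep[of a0 b0 c2 d1 e0 a1 b2 c0 d0 e0]
      sep[of a0 b0 c2 d1 e0 a2 b0 c1 d0 e0] sep[of a0 b1 c0 d0 e0 a0 b1 c2 d2 e0]
      sep[of a0 b1 c0 d0 e0 a0 b1 c2 d3 e0] sep[of a0 b1 c0 d0 e0 a0 b1 c2 d4 e0]
      sep[of a0 b1 c0 d0 e0 a0 b1 c2 d5 e0] sep[of a0 b1 c0 d0 e0 a1 b0 c0 d1 e0]
      sep[of a0 b1 c0 d0 e0 a1 b0 c0 d3 e0] sep[of a0 b1 c0 d0 e0 a1 b0 c0 d4 e0]
      sep[of a0 b1 c0 d0 e0 a1 b0 c0 d5 e0] sep[of a0 b1 c0 d0 e0 a1 b2 c0 d0 e0]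
      sep[of a0 b1 c0 d0 e0 a1 b2 c0 d2 e0] sep[of a0 b1 c0 d0 e0 a1 b2 c0 d3 e0]
      sep[of a0 b1 c0 d0 e0 a1 b2 c0 d4 e0] sep[of a0 b1 c0 d0 e0 a1 b2 c0 d5 e0]
      sep[of a0 b1 c0 d0 e0 a2 b0 c1 d0 e0] sep[of a0 b1 c0 d0 e0 a2 b0 c1 d0 e2]
      sep[of a0 b1 c0 d0 e0 a2 b0 c1 d5 e0] sep[of a0 b1 c0 d1 e0 a0 b1 c2 d5 e0]
      sep[of a0 b1 c0 d2 e0 a0 b2 c0 d1 e0] sep[of a0 b1 c0 d2 e0 a1 b0 c0 d0 e0]
      sep[of a0 b1 c0 d2 e0 a1 b2 c0 d3 e0] sep[of a0 b1 c0 d2 e0 a2 b0 c1 d0 e2]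
      sep[of a0 b1 c2 d0 e0 a0 b2 c0 d2 e0] sep[of a0 b1 c2 d0 e0 a1 b0 c0 d0 e0]
      sep[of a0 b1 c2 d0 e0 a2 b0 c0 d4 e0] sep[of a0 b1 c2 d0 e0 a2 b0 c1 d0 e2]
      sep[of a0 b1 c2 d0 e0 a2 b0 c1 d5 e0] sep[of a0 b1 c2 d3 e0 a1 b0 c0 d3 e0]
      sep[of a0 b1 c2 d3 e0 a2 b0 c1 d0 e2] sep[of a0 b2 c0 d2 e0 a2 b0 c1 d0 e0]
      sep[of a0 b2 c0 d4 e0 a1 b0 c0 d4 e0] sep[of a1 b0 c0 d0 e0 a1 b2 c0 d2 e0]
      sep[of a1 b0 c0 d0 e0 a1 b2 c0 d4 e0] sep[of a1 b0 c0 d0 e0 a2 b0 c1 d0 e0]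
      sep[of a1 b0 c0 d0 e0 a2 b0 c1 d0 e2] sep[of a1 b0 c0 d0 e0 a2 b0 c1 d3 e0]
      sep[of a1 b0 c0 d0 e0 a2 b0 c1 d4 e0] sep[of a1 b0 c0 d0 e0 a2 b0 c1 d5 e0]
      sep[of a1 b0 c0 d4 e0 a1 b2 c0 d1 e0] sep[of a1 b0 c0 d4 e0 a1 b2 c0 d3 e0]
      sep[of a1 b0 c0 d4 e0 a1 b2 c0 d5 e0] sep[of a1 b0 c0 d4 e0 a2 b0 c0 d0 e0]
      sep[of a1 b0 c0 d4 e0 a2 b0 c1 d0 e2] sep[of a1 b0 c0 d4 e0 a2 b2 c0 d4 e0]
      sep[of a1 b0 c0 d5 e0 a2 b2 c0 d5 e0] sep[of a1 b0 c1 d0 e0 a2 b0 c1 d0 e1]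
      sep[of a1 b0 c1 d0 e0 a2 b0 c1 d0 e2] sep[of a2 b0 c1 d5 e0 a2 b0 c1 d0 e2]
    unfolding prod.inject using [[smt_timeout = 300]] by (smt (z3))
qed

text \<open>
The same configuration, but the third ring line leaves through direction 5. Label 4 may now be
constant on that line, and the symmetric argument breaks down. The comparisons remain effective in the
form that a ring point and an unseparated point at another level of direction 4 (or 5) have equal
label 4 (or 5); two points on each ring line whose exit label differs, together with
the base point and the levels at which the lines in directions 4 and 5 through these points stop
being constant, already suffice for a contradiction.
\<close>

lemma no_three_cycle_with_split_exits:
  assumes edges: "F1 b0 c1 d0 e0 \<noteq> F1 b0 c0 d0 e0" "F2 a1 c0 d0 e0 \<noteq> F2 a0 c0 d0 e0"
    "F3 a0 b1 d0 e0 \<noteq> F3 a0 b0 d0 e0" "F4 a1 b2 c0 e0 \<noteq> F4 a1 b0 c0 e0"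
    "F4 a2 b0 c1 e0 \<noteq> F4 a0 b0 c1 e0" "F5 a0 b1 c2 d0 \<noteq> F5 a0 b1 c0 d0"
  shows False
proof -
  obtain d1 where w1: "F1 b0 c0 d1 e0 \<noteq> F1 b0 c0 d0 e0 \<or> F2 a0 c0 d1 e0 \<noteq> F2 a0 c0 d0 e0
      \<or> F3 a0 b0 d1 e0 \<noteq> F3 a0 b0 d0 e0 \<or> F5 a0 b0 c0 d1 \<noteq> F5 a0 b0 c0 d0"
    using no_column(4) by blast
  obtain d2 where w2: "F1 b0 c1 d2 e0 \<noteq> F1 b0 c1 d0 e0 \<or> F2 a0 c1 d2 e0 \<noteq> F2 a0 c1 d0 e0
      \<or> F3 a0 b0 d2 e0 \<noteq> F3 a0 b0 d0 e0 \<or> F5 a0 b0 c1 d2 \<noteq> F5 a0 b0 c1 d0"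
    using no_column(4) by blast
  obtain d3 where w3: "F1 b1 c0 d3 e0 \<noteq> F1 b1 c0 d0 e0 \<or> F2 a0 c0 d3 e0 \<noteq> F2 a0 c0 d0 e0
      \<or> F3 a0 b1 d3 e0 \<noteq> F3 a0 b1 d0 e0 \<or> F5 a0 b1 c0 d3 \<noteq> F5 a0 b1 c0 d0"
    using no_column(4) by blast
  obtain d4 where w4: "F1 b0 c0 d4 e0 \<noteq> F1 b0 c0 d0 e0 \<or> F2 a1 c0 d4 e0 \<noteq> F2 a1 c0 d0 e0
      \<or> F3 a1 b0 d4 e0 \<noteq> F3 a1 b0 d0 e0 \<or> F5 a1 b0 c0 d4 \<noteq> F5 a1 b0 c0 d0"
    using no_column(4) by blast
  obtain d5 where w5: "F1 b2 c0 d5 e0 \<noteq> F1 b2 c0 d0 e0 \<or> F2 a1 c0 d5 e0 \<noteq> F2 a1 c0 d0 e0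
      \<or> F3 a1 b2 d5 e0 \<noteq> F3 a1 b2 d0 e0 \<or> F5 a1 b2 c0 d5 \<noteq> F5 a1 b2 c0 d0"
    using no_column(4) by blast
  obtain d6 where w6: "F1 b0 c1 d6 e0 \<noteq> F1 b0 c1 d0 e0 \<or> F2 a2 c1 d6 e0 \<noteq> F2 a2 c1 d0 e0
      \<or> F3 a2 b0 d6 e0 \<noteq> F3 a2 b0 d0 e0 \<or> F5 a2 b0 c1 d6 \<noteq> F5 a2 b0 c1 d0"
    using no_column(4) by blast
  obtain e1 where w7: "F1 b0 c0 d0 e1 \<noteq> F1 b0 c0 d0 e0 \<or> F2 a0 c0 d0 e1 \<noteq> F2 a0 c0 d0 e0
      \<or> F3 a0 b0 d0 e1 \<noteq> F3 a0 b0 d0 e0 \<or> F4 a0 b0 c0 e1 \<noteq> F4 a0 b0 c0 e0"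
    using no_column(5) by blast
  obtain e2 where w8: "F1 b1 c0 d0 e2 \<noteq> F1 b1 c0 d0 e0 \<or> F2 a0 c0 d0 e2 \<noteq> F2 a0 c0 d0 e0
      \<or> F3 a0 b1 d0 e2 \<noteq> F3 a0 b1 d0 e0 \<or> F4 a0 b1 c0 e2 \<noteq> F4 a0 b1 c0 e0"
    using no_column(5) by blast
  obtain e3 where w9: "F1 b1 c2 d0 e3 \<noteq> F1 b1 c2 d0 e0 \<or> F2 a0 c2 d0 e3 \<noteq> F2 a0 c2 d0 e0
      \<or> F3 a0 b1 d0 e3 \<noteq> F3 a0 b1 d0 e0 \<or> F4 a0 b1 c2 e3 \<noteq> F4 a0 b1 c2 e0"
    using no_column(5) by blast
  show False
    using edges w1 w2 w3 w4 w5 w6 w7 w8 w9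
      sep[of a0 b0 c0 d0 e0 a0 b0 c1 d0 e1] sep[of a0 b0 c0 d0 e0 a0 b0 c1 d2 e0]
      sep[of a0 b0 c0 d0 e0 a0 b0 c2 d0 e1] sep[of a0 b0 c0 d0 e0 a0 b1 c0 d0 e1]
      sep[of a0 b0 c0 d0 e0 a0 b1 c0 d0 e2] sep[of a0 b0 c0 d0 e0 a0 b1 c0 d1 e0]
      sep[of a0 b0 c0 d0 e0 a0 b1 c0 d3 e0] sep[of a0 b0 c0 d0 e0 a0 b1 c2 d0 e3]
      sep[of a0 b0 c0 d0 e0 a1 b0 c0 d0 e1] sep[of a0 b0 c0 d0 e0 a1 b0 c0 d1 e0]
      sep[of a0 b0 c0 d0 e0 a1 b0 c0 d4 e0] sep[of a0 b0 c0 d0 e0 a1 b0 c0 d6 e0]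
      sep[of a0 b0 c0 d0 e0 a1 b1 c0 d0 e0] sep[of a0 b0 c0 d0 e0 a1 b2 c0 d1 e0]
      sep[of a0 b0 c0 d0 e0 a1 b2 c0 d3 e0] sep[of a0 b0 c0 d0 e0 a2 b0 c1 d0 e0]
      sep[of a0 b0 c0 d0 e0 a2 b0 c1 d6 e0] sep[of a0 b0 c0 d0 e1 a0 b1 c2 d0 e0]
      sep[of a0 b0 c0 d0 e1 a0 b2 c0 d1 e0] sep[of a0 b0 c0 d0 e1 a1 b0 c0 d4 e0]
      sep[of a0 b0 c0 d0 e1 a1 b2 c0 d0 e0] sep[of a0 b0 c0 d0 e1 a1 b2 c0 d5 e0]
      sep[of a0 b0 c0 d0 e1 a2 b0 c1 d0 e0] sep[of a0 b0 c0 d0 e1 a2 b0 c1 d6 e0]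
      sep[of a0 b0 c0 d1 e0 a0 b0 c0 d0 e1] sep[of a0 b0 c0 d1 e0 a0 b0 c1 d0 e1]
      sep[of a0 b0 c0 d1 e0 a0 b0 c2 d0 e1] sep[of a0 b0 c0 d1 e0 a0 b1 c0 d0 e2]
      sep[of a0 b0 c0 d1 e0 a0 b1 c0 d5 e0] sep[of a0 b0 c0 d1 e0 a0 b1 c2 d0 e0]
      sep[of a0 b0 c0 d1 e0 a0 b1 c2 d0 e3] sep[of a0 b0 c0 d1 e0 a1 b0 c1 d1 e0]
      sep[of a0 b0 c0 d1 e0 a1 b2 c0 d3 e0] sep[of a0 b0 c0 d3 e0 a1 b0 c0 d6 e0]
      sep[of a0 b0 c0 d3 e0 a1 b1 c0 d3 e0] sep[of a0 b0 c0 d4 e0 a0 b1 c0 d5 e0]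
      sep[of a0 b0 c0 d4 e0 a1 b2 c0 d0 e0] sep[of a0 b0 c1 d0 e0 a1 b0 c0 d4 e0]
      sep[of a0 b0 c1 d0 e0 a1 b2 c0 d0 e0] sep[of a0 b0 c1 d0 e0 a1 b2 c0 d5 e0]
      sep[of a0 b0 c1 d0 e0 a2 b0 c1 d2 e0] sep[of a0 b0 c1 d0 e0 a2 b0 c1 d6 e0]
      sep[of a0 b0 c1 d0 e1 a0 b0 c1 d2 e0] sep[of a0 b0 c1 d1 e0 a1 b0 c0 d0 e0]
      sep[of a0 b0 c1 d1 e0 a2 b0 c0 d0 e0] sep[of a0 b0 c1 d1 e0 a2 b0 c1 d0 e0]
      sep[of a0 b0 c1 d2 e0 a0 b1 c0 d0 e0] sep[of a0 b0 c2 d0 e0 a0 b1 c0 d0 e0]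
      sep[of a0 b0 c2 d0 e0 a0 b1 c1 d0 e0] sep[of a0 b0 c2 d0 e1 a0 b2 c0 d1 e0]
      sep[of a0 b0 c2 d0 e1 a1 b2 c0 d0 e0] sep[of a0 b0 c2 d0 e1 a1 b2 c0 d5 e0]
      sep[of a0 b0 c2 d0 e1 a2 b0 c1 d0 e0] sep[of a0 b0 c2 d0 e1 a2 b0 c1 d6 e0]
      sep[of a0 b0 c2 d0 e2 a0 b1 c2 d0 e1] sep[of a0 b0 c2 d0 e2 a0 b1 c2 d0 e3]
      sep[of a0 b1 c0 d0 e0 a0 b1 c1 d3 e0] sep[of a0 b1 c0 d0 e0 a0 b1 c2 d0 e2]
      sep[of a0 b1 c0 d0 e0 a0 b1 c2 d0 e3] sep[of a0 b1 c0 d0 e0 a1 b2 c0 d5 e0]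
      sep[of a0 b1 c0 d0 e0 a2 b0 c1 d0 e0] sep[of a0 b1 c0 d0 e0 a2 b0 c1 d6 e0]
      sep[of a0 b1 c0 d0 e2 a1 b0 c0 d0 e0] sep[of a0 b1 c0 d0 e2 a1 b0 c0 d4 e0]
      sep[of a0 b1 c0 d0 e2 a1 b2 c0 d0 e0] sep[of a0 b1 c0 d0 e2 a1 b2 c0 d5 e0]
      sep[of a0 b1 c0 d3 e0 a0 b1 c0 d0 e2] sep[of a0 b1 c0 d3 e0 a0 b1 c2 d0 e3]
      sep[of a0 b1 c1 d0 e0 a0 b1 c2 d3 e0] sep[of a0 b1 c2 d0 e0 a1 b0 c0 d0 e0]
      sep[of a0 b1 c2 d0 e0 a2 b0 c0 d1 e0] sep[of a0 b1 c2 d0 e3 a0 b2 c0 d1 e0]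
      sep[of a0 b1 c2 d0 e3 a1 b0 c0 d0 e0] sep[of a0 b1 c2 d0 e3 a1 b0 c0 d4 e0]
      sep[of a0 b1 c2 d0 e3 a1 b2 c0 d0 e0] sep[of a0 b1 c2 d0 e3 a1 b2 c0 d5 e0]
      sep[of a0 b2 c0 d0 e0 a1 b0 c0 d0 e0] sep[of a0 b2 c0 d0 e0 a1 b0 c0 d1 e0]
      sep[of a0 b2 c0 d1 e0 a2 b0 c1 d0 e0] sep[of a0 b2 c0 d3 e0 a1 b1 c0 d3 e0]
      sep[of a1 b0 c0 d0 e0 a1 b2 c0 d4 e0] sep[of a1 b0 c0 d0 e0 a1 b2 c0 d5 e0]
      sep[of a1 b0 c0 d0 e0 a2 b0 c1 d0 e0] sep[of a1 b0 c0 d1 e0 a1 b2 c0 d2 e0]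
      sep[of a1 b0 c0 d1 e0 a1 b2 c0 d3 e0] sep[of a1 b0 c0 d1 e0 a2 b0 c1 d0 e0]
      sep[of a1 b0 c0 d2 e0 a1 b2 c0 d0 e0] sep[of a1 b0 c0 d4 e0 a2 b0 c1 d0 e0]
      sep[of a1 b2 c0 d3 e0 a2 b0 c0 d1 e0] sep[of a1 b2 c0 d5 e0 a2 b0 c1 d0 e0]
      sep[of a2 b0 c0 d0 e0 a2 b0 c1 d1 e0]
    unfolding prod.inject using [[smt_timeout = 300]] by (smt (z3))
qed

end

context columnless
begin

text \<open>For a three-cycle at \<open>z\<close>, move along \<open>i3\<close> to a point where label \<open>i1\<close> has changed. The line in
direction \<open>i1\<close> through that point is constant in the labels of the cycle. It is not a column, so one of the
other two labels changes along it. The remaining two ring lines arise by rotating the cycle.\<close>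

lemma ring_exit:
  assumes "f i2 (z(i1 := p)) \<noteq> f i2 z" "f i3 (z(i2 := q)) \<noteq> f i3 z" "f i1 (z(i3 := r)) \<noteq> f i1 z"
  shows "varies f i1 i4 (z(i3 := r)) \<or> varies f i1 i5 (z(i3 := r))"
proof -
  obtain a b c d e where z: "z = P a b c d e" using P_of by blast
  have cycle: "F2 p c d e \<noteq> F2 a c d e" "F3 a q d e \<noteq> F3 a b d e" "F1 b r d e \<noteq> F1 b c d e"
    using assms by (simp_all add: z P_upd f_P)
  obtain k where k: "F2 k r d e \<noteq> F2 a r d e \<or> F3 k b d e \<noteq> F3 a b d e
      \<or> F4 k b r e \<noteq> F4 a b r e \<or> F5 k b r d \<noteq> F5 a b r d"
    using no_column(1) by blast
  have F3: "F3 k b d e = F3 a b d e" for k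
    using cycle(3) sep[of k b c d e a b r d e] by auto
  have "F2 k r d e = F2 a c d e" for k
    using cycle F3[of k] sep[of k b r d e a q c d e] sep[of p b c d e a q c d e] by auto
  with k F3 show ?thesis
    unfolding z P_upd varies_P f_P by auto
qed

lemma common_exit_impossible:
  assumes "f i2 (z(i1 := p)) \<noteq> f i2 z" "f i3 (z(i2 := q)) \<noteq> f i3 z" "f i1 (z(i3 := r)) \<noteq> f i1 z"
    and "varies f i1 i4 (z(i3 := r))" "varies f i2 i4 (z(i1 := p))" "varies f i3 i4 (z(i2 := q))"
  shows False
proof -
  obtain a b c d e where z: "z = P a b c d e" using P_of by blast
  show False
    using assms no_three_cycle_with_common_exit[of b r d e c p a q]
    unfolding z P_upd varies_P f_P by blast
qed

lemma split_exits_impossible: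
  assumes "f i2 (z(i1 := p)) \<noteq> f i2 z" "f i3 (z(i2 := q)) \<noteq> f i3 z" "f i1 (z(i3 := r)) \<noteq> f i1 z"
    and "varies f i1 i4 (z(i3 := r))" "varies f i2 i4 (z(i1 := p))" "varies f i3 i5 (z(i2 := q))"
  shows False
proof -
  obtain a b c d e where z: "z = P a b c d e" using P_of by blast
  show False
    using assms no_three_cycle_with_split_exits[of b r d e c p a q]
    unfolding z P_upd varies_P f_P by blast
qed

end

lemma columnless_rotate:
  assumes "columnless f i j k l m"
  shows "columnless f j k i l m"
proof -
  interpret columnless f i j k l m by (rule assms)
  show ?thesis
    using labelling distinct univ columnless by unfold_locales auto
qed

lemma columnless_swap:
  assumes "columnless f i j k l m"
  shows "columnless f i j k m l"
proof -
  interpret columnless f i j k l m by (rule assms)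
  show ?thesis
    using labelling distinct univ columnless by unfold_locales auto
qed

text \<open>Rotating the cycle and exchanging the two remaining directions reduces the eight ways in which
the three ring lines can leave the cycle to the two excluded above.\<close>

lemma no_three_cycle:
  assumes "columnless f i j k l m" "varies f i j z" "varies f j k z"
  shows "\<not> varies f k i z"
proof
  assume "varies f k i z"
  with assms obtain p q r
    where c: "f j (z(i := p)) \<noteq> f j z" "f k (z(j := q)) \<noteq> f k z" "f i (z(k := r)) \<noteq> f i z"
    unfolding varies_def by blast
  note C1 = assms(1)
  note C2 = columnless_rotate[OF C1]
  note C3 = columnless_rotate[OF C2]
  note S1 = columnless_swap[OF C1]
  note S2 = columnless_swap[OF C2]
  note S3 = columnless_swap[OF C3]
  let ?R = "\<lambda>n. varies f i n (z(k := r))" and ?S = "\<lambda>n. varies f j n (z(i := p))"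
    and ?T = "\<lambda>n. varies f k n (z(j := q))"
  have "?R l \<or> ?R m" "?S l \<or> ?S m" "?T l \<or> ?T m"
    using columnless.ring_exit[OF C1 c(1,2,3)] columnless.ring_exit[OF C2 c(2,3,1)]
      columnless.ring_exit[OF C3 c(3,1,2)] by blast+
  moreover have "\<not> (?R l \<and> ?S l \<and> ?T l)" "\<not> (?R m \<and> ?S m \<and> ?T m)"
    using columnless.common_exit_impossible[OF C1 c(1,2,3)] columnless.common_exit_impossible[OF S1 c(1,2,3)] by blast+
  moreover have "\<not> (?R l \<and> ?S l \<and> ?T m)" "\<not> (?S l \<and> ?T l \<and> ?R m)" "\<not> (?T l \<and> ?R l \<and> ?S m)"
    using columnless.split_exits_impossible[OF C1 c(1,2,3)] columnless.split_exits_impossible[OF C2 c(2,3,1)]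
      columnless.split_exits_impossible[OF C3 c(3,1,2)] by blast+
  moreover have "\<not> (?R m \<and> ?S m \<and> ?T l)" "\<not> (?S m \<and> ?T m \<and> ?R l)" "\<not> (?T m \<and> ?R m \<and> ?S l)"
    using columnless.split_exits_impossible[OF S1 c(1,2,3)] columnless.split_exits_impossible[OF S2 c(2,3,1)]
      columnless.split_exits_impossible[OF S3 c(3,1,2)] by blast+
  ultimately show False by blast
qed

section \<open>Longer cycles\<close>

locale acyclic_columnless = columnless +
  assumes acyclic: "\<lbrakk>varies f i j z; varies f j k z\<rbrakk> \<Longrightarrow> \<not> varies f k i z"
begin

text \<open>\<open>flat_dichotomy\<close> in coordinates, for each of the ten triples of directions.\<close>

lemma flat123:
  "(\<forall>b c b' c'. F1 b c d e = F1 b' c' d e)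
    \<or> (\<forall>a c a' c'. F2 a c d e = F2 a' c' d e)
    \<or> (\<forall>a b a' b'. F3 a b d e = F3 a' b' d e)"
  using flat_dichotomy[OF labelling _ acyclic, where i = i1 and j = i2 and k = i3 and z = "P 0 0 0 d e"] distinct
  by (simp add: P_upd f_P)

lemma flat124:
  "(\<forall>b d b' d'. F1 b c d e = F1 b' c d' e)
    \<or> (\<forall>a d a' d'. F2 a c d e = F2 a' c d' e)
    \<or> (\<forall>a b a' b'. F4 a b c e = F4 a' b' c e)"
  using flat_dichotomy[OF labelling _ acyclic, where i = i1 and j = i2 and k = i4 and z = "P 0 0 c 0 e"] distinct
  by (simp add: P_upd f_P)

lemma flat125:
  "(\<forall>b e b' e'. F1 b c d e = F1 b' c d e')
    \<or> (\<forall>a e a' e'. F2 a c d e = F2 a' c d e')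
    \<or> (\<forall>a b a' b'. F5 a b c d = F5 a' b' c d)"
  using flat_dichotomy[OF labelling _ acyclic, where i = i1 and j = i2 and k = i5 and z = "P 0 0 c d 0"] distinct
  by (simp add: P_upd f_P)

lemma flat134:
  "(\<forall>c d c' d'. F1 b c d e = F1 b c' d' e)
    \<or> (\<forall>a d a' d'. F3 a b d e = F3 a' b d' e)
    \<or> (\<forall>a c a' c'. F4 a b c e = F4 a' b c' e)"
  using flat_dichotomy[OF labelling _ acyclic, where i = i1 and j = i3 and k = i4 and z = "P 0 b 0 0 e"] distinct
  by (simp add: P_upd f_P)

lemma flat135:
  "(\<forall>c e c' e'. F1 b c d e = F1 b c' d e')
    \<or> (\<forall>a e a' e'. F3 a b d e = F3 a' b d e')
    \<or> (\<forall>a c a' c'. F5 a b c d = F5 a' b c' d)"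
  using flat_dichotomy[OF labelling _ acyclic, where i = i1 and j = i3 and k = i5 and z = "P 0 b 0 d 0"] distinct
  by (simp add: P_upd f_P)

lemma flat145:
  "(\<forall>d e d' e'. F1 b c d e = F1 b c d' e')
    \<or> (\<forall>a e a' e'. F4 a b c e = F4 a' b c e')
    \<or> (\<forall>a d a' d'. F5 a b c d = F5 a' b c d')"
  using flat_dichotomy[OF labelling _ acyclic, where i = i1 and j = i4 and k = i5 and z = "P 0 b c 0 0"] distinct
  by (simp add: P_upd f_P)

lemma flat234:
  "(\<forall>c d c' d'. F2 a c d e = F2 a c' d' e)
    \<or> (\<forall>b d b' d'. F3 a b d e = F3 a b' d' e)
    \<or> (\<forall>b c b' c'. F4 a b c e = F4 a b' c' e)"
  using flat_dichotomy[OF labelling _ acyclic, where i = i2 and j = i3 and k = i4 and z = "P a 0 0 0 e"] distinct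
  by (simp add: P_upd f_P)

lemma flat235:
  "(\<forall>c e c' e'. F2 a c d e = F2 a c' d e')
    \<or> (\<forall>b e b' e'. F3 a b d e = F3 a b' d e')
    \<or> (\<forall>b c b' c'. F5 a b c d = F5 a b' c' d)"
  using flat_dichotomy[OF labelling _ acyclic, where i = i2 and j = i3 and k = i5 and z = "P a 0 0 d 0"] distinct
  by (simp add: P_upd f_P)

lemma flat245:
  "(\<forall>d e d' e'. F2 a c d e = F2 a c d' e')
    \<or> (\<forall>b e b' e'. F4 a b c e = F4 a b' c e')
    \<or> (\<forall>b d b' d'. F5 a b c d = F5 a b' c d')"
  using flat_dichotomy[OF labelling _ acyclic, where i = i2 and j = i4 and k = i5 and z = "P a 0 c 0 0"] distinct
  by (simp add: P_upd f_P)

lemma flat345: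
  "(\<forall>d e d' e'. F3 a b d e = F3 a b d' e')
    \<or> (\<forall>c e c' e'. F4 a b c e = F4 a b c' e')
    \<or> (\<forall>c d c' d'. F5 a b c d = F5 a b c' d')"
  using flat_dichotomy[OF labelling _ acyclic, where i = i3 and j = i4 and k = i5 and z = "P a b 0 0 0"] distinct
  by (simp add: P_upd f_P)

text \<open>
Two consecutive arrows \<open>i \<rightarrow> j \<rightarrow> k\<close> at a point show that the labels \<open>j\<close> and \<open>k\<close> are not constant on the flat
spanned by \<open>i\<close>, \<open>j\<close>, \<open>k\<close>, so label \<open>i\<close> is, and no arrow of that flat enters \<open>i\<close>. Applied to the cycle
\<open>1 \<rightarrow> 2 \<rightarrow> 3 \<rightarrow> 4 \<rightarrow> 1\<close> and to \<open>5 \<rightarrow> 1 \<rightarrow> 2\<close> this rules out arrows between opposite directions of the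
four-cycle, and it restricts which arrows can leave the next direction at a point one or two steps away from the base point. The lines examined
in the proof are those where an arrow of the pattern has to be found again; with every choice
some pair of points is left without a separating coordinate.
\<close>

lemma no_four_cycle:
  assumes edges: "F1 b0 c0 d1 e0 \<noteq> F1 b0 c0 d0 e0" "F1 b0 c0 d0 e1 \<noteq> F1 b0 c0 d0 e0"
    "F2 a1 c0 d0 e0 \<noteq> F2 a0 c0 d0 e0" "F3 a0 b1 d0 e0 \<noteq> F3 a0 b0 d0 e0"
    "F4 a0 b0 c1 e0 \<noteq> F4 a0 b0 c0 e0"
  shows False
proof -
  obtain a2 where w1: "F2 a2 c0 d0 e1 \<noteq> F2 a0 c0 d0 e1 \<or> F3 a2 b0 d0 e1 \<noteq> F3 a0 b0 d0 e1
      \<or> F4 a2 b0 c0 e1 \<noteq> F4 a0 b0 c0 e1 \<or> F5 a2 b0 c0 d0 \<noteq> F5 a0 b0 c0 d0"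
    using no_column(1) by blast
  obtain a3 where w2: "F2 a3 c0 d1 e0 \<noteq> F2 a0 c0 d1 e0 \<or> F3 a3 b0 d1 e0 \<noteq> F3 a0 b0 d1 e0
      \<or> F4 a3 b0 c0 e0 \<noteq> F4 a0 b0 c0 e0 \<or> F5 a3 b0 c0 d1 \<noteq> F5 a0 b0 c0 d1"
    using no_column(1) by blast
  obtain b2 where w3: "F1 b2 c0 d0 e0 \<noteq> F1 b0 c0 d0 e0 \<or> F3 a1 b2 d0 e0 \<noteq> F3 a1 b0 d0 e0
      \<or> F4 a1 b2 c0 e0 \<noteq> F4 a1 b0 c0 e0 \<or> F5 a1 b2 c0 d0 \<noteq> F5 a1 b0 c0 d0"
    using no_column(2) by blast
  obtain c2 where w4: "F1 b1 c2 d0 e0 \<noteq> F1 b1 c0 d0 e0 \<or> F2 a0 c2 d0 e0 \<noteq> F2 a0 c0 d0 e0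
      \<or> F4 a0 b1 c2 e0 \<noteq> F4 a0 b1 c0 e0 \<or> F5 a0 b1 c2 d0 \<noteq> F5 a0 b1 c0 d0"
    using no_column(3) by blast
  obtain c3 where w5: "F1 b0 c3 d0 e0 \<noteq> F1 b0 c0 d0 e0 \<or> F2 a1 c3 d0 e0 \<noteq> F2 a1 c0 d0 e0
      \<or> F4 a1 b0 c3 e0 \<noteq> F4 a1 b0 c0 e0 \<or> F5 a1 b0 c3 d0 \<noteq> F5 a1 b0 c0 d0"
    using no_column(3) by blast
  obtain c4 where w6: "F1 b1 c4 d0 e0 \<noteq> F1 b1 c0 d0 e0 \<or> F2 a1 c4 d0 e0 \<noteq> F2 a1 c0 d0 e0
      \<or> F4 a1 b1 c4 e0 \<noteq> F4 a1 b1 c0 e0 \<or> F5 a1 b1 c4 d0 \<noteq> F5 a1 b1 c0 d0"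
    using no_column(3) by blast
  obtain d2 where w7: "F1 b0 c1 d2 e0 \<noteq> F1 b0 c1 d0 e0 \<or> F2 a0 c1 d2 e0 \<noteq> F2 a0 c1 d0 e0
      \<or> F3 a0 b0 d2 e0 \<noteq> F3 a0 b0 d0 e0 \<or> F5 a0 b0 c1 d2 \<noteq> F5 a0 b0 c1 d0"
    using no_column(4) by blast
  show False
    using edges w1 w2 w3 w4 w5 w6 w7
      flat123[of d0 e0] flat123[of d1 e0] flat125[of c0 d0] flat134[of b0 e0] flat134[of b1 e0]
      flat135[of b1 d0] flat145[of b0 c0] flat234[of a0 e0] flat234[of a1 e0] flat235[of a0 d0]
      flat235[of a1 d0] flat345[of a0 b0] sep[of a0 b0 c0 d0 e0 a1 b0 c0 d1 e0]
      sep[of a0 b0 c0 d0 e1 a1 b1 c4 d0 e0] sep[of a0 b0 c0 d1 e0 a1 b2 c0 d0 e0]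
      sep[of a0 b0 c1 d1 e0 a1 b2 c0 d0 e0] sep[of a0 b0 c1 d2 e0 a1 b2 c0 d0 e0]
      sep[of a0 b1 c0 d1 e0 a1 b0 c0 d1 e0] sep[of a0 b1 c2 d0 e0 a0 b1 c0 d1 e0]
      sep[of a0 b3 c0 d0 e1 a1 b0 c0 d0 e1] sep[of a0 b3 c0 d0 e1 a1 b1 c0 d0 e1]
      sep[of a1 b2 c0 d0 e0 a1 b0 c3 d0 e0] sep[of a2 b0 c0 d0 e1 a1 b0 c3 d0 e0]
      sep[of a2 b0 c0 d0 e1 a1 b1 c0 d0 e1] sep[of a2 b0 c0 d0 e1 a1 b1 c4 d0 e0]
      sep[of a3 b0 c0 d1 e0 a1 b0 c0 d0 e0]
    unfolding prod.inject using [[smt_timeout = 300]] by (smt (z3))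
qed

text \<open>
The same reasoning for \<open>1 \<rightarrow> 2 \<rightarrow> 3 \<rightarrow> 4 \<rightarrow> 5 \<rightarrow> 1\<close>. The chords of a five-cycle are not all excluded by the
flats, so more lines near the base point have to be examined.
\<close>

lemma no_five_cycle:
  assumes edges: "F1 b0 c0 d0 e1 \<noteq> F1 b0 c0 d0 e0" "F2 a1 c0 d0 e0 \<noteq> F2 a0 c0 d0 e0"
    "F3 a0 b1 d0 e0 \<noteq> F3 a0 b0 d0 e0" "F4 a0 b0 c1 e0 \<noteq> F4 a0 b0 c0 e0"
    "F5 a0 b0 c0 d1 \<noteq> F5 a0 b0 c0 d0"
  shows False
proof -
  obtain a2 where w1: "F2 a2 c0 d0 e1 \<noteq> F2 a0 c0 d0 e1 \<or> F3 a2 b0 d0 e1 \<noteq> F3 a0 b0 d0 e1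
      \<or> F4 a2 b0 c0 e1 \<noteq> F4 a0 b0 c0 e1 \<or> F5 a2 b0 c0 d0 \<noteq> F5 a0 b0 c0 d0"
    using no_column(1) by blast
  obtain a3 where w2: "F2 a3 c1 d0 e0 \<noteq> F2 a0 c1 d0 e0 \<or> F3 a3 b0 d0 e0 \<noteq> F3 a0 b0 d0 e0
      \<or> F4 a3 b0 c1 e0 \<noteq> F4 a0 b0 c1 e0 \<or> F5 a3 b0 c1 d0 \<noteq> F5 a0 b0 c1 d0"
    using no_column(1) by blast
  obtain a4 where w3: "F2 a4 c1 d0 e1 \<noteq> F2 a0 c1 d0 e1 \<or> F3 a4 b0 d0 e1 \<noteq> F3 a0 b0 d0 e1
      \<or> F4 a4 b0 c1 e1 \<noteq> F4 a0 b0 c1 e1 \<or> F5 a4 b0 c1 d0 \<noteq> F5 a0 b0 c1 d0"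
    using no_column(1) by blast
  obtain b2 where w4: "F1 b2 c0 d0 e0 \<noteq> F1 b0 c0 d0 e0 \<or> F3 a1 b2 d0 e0 \<noteq> F3 a1 b0 d0 e0
      \<or> F4 a1 b2 c0 e0 \<noteq> F4 a1 b0 c0 e0 \<or> F5 a1 b2 c0 d0 \<noteq> F5 a1 b0 c0 d0"
    using no_column(2) by blast
  obtain b3 where w5: "F1 b3 c1 d0 e0 \<noteq> F1 b0 c1 d0 e0 \<or> F3 a1 b3 d0 e0 \<noteq> F3 a1 b0 d0 e0
      \<or> F4 a1 b3 c1 e0 \<noteq> F4 a1 b0 c1 e0 \<or> F5 a1 b3 c1 d0 \<noteq> F5 a1 b0 c1 d0"
    using no_column(2) by blast
  obtain c2 where w6: "F1 b1 c2 d0 e0 \<noteq> F1 b1 c0 d0 e0 \<or> F2 a0 c2 d0 e0 \<noteq> F2 a0 c0 d0 e0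
      \<or> F4 a0 b1 c2 e0 \<noteq> F4 a0 b1 c0 e0 \<or> F5 a0 b1 c2 d0 \<noteq> F5 a0 b1 c0 d0"
    using no_column(3) by blast
  obtain d2 where w7: "F1 b0 c1 d2 e0 \<noteq> F1 b0 c1 d0 e0 \<or> F2 a0 c1 d2 e0 \<noteq> F2 a0 c1 d0 e0
      \<or> F3 a0 b0 d2 e0 \<noteq> F3 a0 b0 d0 e0 \<or> F5 a0 b0 c1 d2 \<noteq> F5 a0 b0 c1 d0"
    using no_column(4) by blast
  obtain e2 where w8: "F1 b0 c0 d1 e2 \<noteq> F1 b0 c0 d1 e0 \<or> F2 a0 c0 d1 e2 \<noteq> F2 a0 c0 d1 e0
      \<or> F3 a0 b0 d1 e2 \<noteq> F3 a0 b0 d1 e0 \<or> F4 a0 b0 c0 e2 \<noteq> F4 a0 b0 c0 e0"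
    using no_column(5) by blast
  obtain e3 where w9: "F1 b0 c1 d0 e3 \<noteq> F1 b0 c1 d0 e0 \<or> F2 a0 c1 d0 e3 \<noteq> F2 a0 c1 d0 e0
      \<or> F3 a0 b0 d0 e3 \<noteq> F3 a0 b0 d0 e0 \<or> F4 a0 b0 c1 e3 \<noteq> F4 a0 b0 c1 e0"
    using no_column(5) by blast
  obtain e4 where w10: "F1 b0 c1 d1 e4 \<noteq> F1 b0 c1 d1 e0 \<or> F2 a0 c1 d1 e4 \<noteq> F2 a0 c1 d1 e0
      \<or> F3 a0 b0 d1 e4 \<noteq> F3 a0 b0 d1 e0 \<or> F4 a0 b0 c1 e4 \<noteq> F4 a0 b0 c1 e0"
    using no_column(5) by blast
  show False
    using edges w1 w2 w3 w4 w5 w6 w7 w8 w9 w10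
      flat123[of d0 e0] flat123[of d0 e1] flat124[of c1 e0] flat125[of c0 d0] flat125[of c0 d1]
      flat125[of c1 d0] flat134[of b0 e0] flat135[of b0 d0] flat145[of b0 c0] flat145[of b0 c1]
      flat234[of a0 e0] flat234[of a1 e0] flat235[of a0 d1] flat235[of a1 d0] flat245[of a0 c0]
      flat245[of a0 c1] flat345[of a0 b0] flat345[of a0 b1] sep[of a0 b0 c0 d0 e1 a0 b1 c1 d0 e1]
      sep[of a0 b0 c0 d0 e1 a0 b1 c2 d0 e0] sep[of a0 b0 c0 d1 e0 a1 b2 c0 d0 e0]
      sep[of a0 b0 c0 d1 e0 a1 b3 c1 d0 e0] sep[of a0 b0 c0 d1 e2 a0 b1 c2 d0 e0]
      sep[of a0 b0 c0 d1 e2 a1 b1 c0 d0 e0] sep[of a0 b0 c0 d1 e2 a1 b2 c0 d0 e0]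
      sep[of a0 b0 c1 d2 e0 a0 b0 c1 d0 e3] sep[of a0 b0 c1 d2 e0 a0 b1 c0 d0 e1]
      sep[of a0 b0 c1 d2 e0 a1 b2 c0 d0 e0] sep[of a0 b1 c0 d1 e0 a1 b0 c0 d1 e0]
      sep[of a0 b1 c0 d1 e0 a1 b1 c0 d0 e1] sep[of a0 b1 c1 d0 e0 a1 b0 c0 d0 e1]
      sep[of a0 b1 c1 d1 e0 a1 b0 c0 d1 e0] sep[of a0 b1 c2 d0 e0 a0 b1 c0 d1 e0]
      sep[of a1 b1 c0 d0 e1 a1 b1 c0 d1 e0] sep[of a2 b0 c0 d0 e1 a0 b0 c1 d0 e1]
      sep[of a2 b0 c0 d0 e1 a0 b0 c1 d2 e0] sep[of a2 b0 c0 d0 e1 a0 b1 c2 d0 e0]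
      sep[of a3 b0 c1 d0 e0 a0 b0 c1 d2 e0] sep[of a4 b0 c1 d0 e1 a0 b0 c0 d1 e0]
      sep[of a4 b0 c1 d0 e1 a0 b1 c0 d1 e0]
    unfolding prod.inject using [[smt_timeout = 300]] by (smt (z3))
qed

end

section \<open>Existence of a column\<close>

context acyclic_columnless
begin

lemma no_four_cycle_varies:
  assumes "varies f i1 i2 z" "varies f i2 i3 z" "varies f i3 i4 z" "varies f i4 i1 z" "varies f i5 i1 z"
  shows False
proof -
  obtain a b c d e where z: "z = P a b c d e" using P_of by blast
  show False
    using assms no_four_cycle[of b c _ e d _ _ a]
    unfolding z varies_P f_P by blast
qed

lemma no_five_cycle_varies:
  assumes "varies f i1 i2 z" "varies f i2 i3 z" "varies f i3 i4 z" "varies f i4 i5 z" "varies f i5 i1 z"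
  shows False
proof -
  obtain a b c d e where z: "z = P a b c d e" using P_of by blast
  show False
    using assms no_five_cycle[of b c d _ e _ a]
    unfolding z varies_P f_P by blast
qed

end

text \<open>If an arrow leaves every direction, choose one at each direction of a fixed point and follow the
chosen arrows. Two-cycles and three-cycles are impossible, so the first four directions visited are
distinct; then the walk closes up to a four-cycle, which the fifth direction must enter, or it
visits all five directions and closes up to a four-cycle or a five-cycle.\<close>

lemma constant_line_exists:
  fixes f :: "'i::finite \<Rightarrow> ('i \<Rightarrow> int) \<Rightarrow> 'c"
  assumes "keller_labelling f" and five: "CARD('i) = 5"
  shows "\<exists>z i. \<forall>j k. f j (z(i := k)) = f j z"
proof (rule ccontr)
  assume "\<not> ?thesis"
  then have out: "\<exists>j. varies f i j z" for z i unfolding varies_def by blast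
  have card: "UNIV = set xs" if "distinct xs" "length xs = 5" for xs :: "'i list"
    using that five by (metis card_subset_eq distinct_card finite subset_UNIV)
  have frame: "columnless f a b c d e" if "distinct [a, b, c, d, e]" for a b c d e
    using assms(1) that out card[OF that] by unfold_locales auto
  have rest: "\<exists>e. e \<notin> set xs" if "length xs < 5" for xs :: "'i list"
  proof -
    have "card (set xs) < CARD('i)" using card_length[of xs] that five by simp
    then have "set xs \<noteq> UNIV" by force
    then show ?thesis by blast
  qed
  have no_loop: "i \<noteq> j" if "varies f i j z" for i j z
    using that varies_irrefl[OF assms(1)] by blast
  have acyclic: "\<not> varies f k i z" if "varies f i j z" "varies f j k z" for i j k z
  proof
    assume ki: "varies f k i z"
    then have d: "distinct [i, j, k]" using that no_loop by auto
    obtain l where l: "l \<notin> set [i, j, k]" using rest[of "[i, j, k]"] by auto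
    obtain m where m: "m \<notin> set [i, j, k, l]" using rest[of "[i, j, k, l]"] by auto
    have "columnless f i j k l m" by (rule frame) (use d l m in auto)
    then show False using no_three_cycle[OF _ that] ki by blast
  qed
  have acyclic_frame: "acyclic_columnless f a b c d e" if "distinct [a, b, c, d, e]" for a b c d e
  proof -
    interpret columnless f a b c d e by (rule frame[OF that])
    show ?thesis by unfold_locales (rule acyclic)
  qed
  fix z :: "'i \<Rightarrow> int"
  define g where "g i = (SOME j. varies f i j z)" for i
  have g: "varies f i (g i) z" for i unfolding g_def using out by (rule someI_ex)
  have g1: "g i \<noteq> i" for i using no_loop[OF g[of i]] by simp
  have g2: "g (g i) \<noteq> i" for i using varies_asym[OF assms(1) g[of i]] g[of "g i"] by auto
  have g3: "g (g (g i)) \<noteq> i" for i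
    using acyclic[OF g[of i] g[of "g i"]] g[of "g (g i)"] by auto
  have no_four: False if d: "distinct [a, b, c, d]" and "g a = b" "g b = c" "g c = d" "g d = a" for a b c d
  proof -
    obtain e where e: "e \<notin> set [a, b, c, d]" using rest[of "[a, b, c, d]"] by auto
    have "UNIV = set [a, b, c, d, e]" by (rule card) (use d e in auto)
    then consider "g e = a" | "g e = b" | "g e = c" | "g e = d" using g1[of e] by auto
    moreover have short: False if "g e = a'" "distinct [a', b', c', d', e]" "g a' = b'" "g b' = c'" "g c' = d'" "g d' = a'"
      for a' b' c' d'
      using acyclic_columnless.no_four_cycle_varies[OF acyclic_frame[OF that(2)], of z]
        g[of a'] g[of b'] g[of c'] g[of d'] g[of e] that by simp
    ultimately show False
    proof cases
      case 1 then show False using short[of a b c d] that e by auto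
    next
      case 2 then show False using short[of b c d a] that e by auto
    next
      case 3 then show False using short[of c d a b] that e by auto
    next
      case 4 then show False using short[of d a b c] that e by auto
    qed
  qed
  fix i0 :: 'i
  define i1 where "i1 = g i0"
  define i2 where "i2 = g i1"
  define i3 where "i3 = g i2"
  define i4 where "i4 = g i3"
  note i = i1_def i2_def i3_def i4_def
  have d: "distinct [i0, i1, i2, i3]"
    using g1[of i0] g1[of i1] g1[of i2] g2[of i0] g2[of i1] g3[of i0] by (auto simp: i)
  have "i4 \<noteq> i3" "i4 \<noteq> i2" "i4 \<noteq> i1" using g1[of i3] g2[of i2] g3[of i1] by (auto simp: i)
  moreover have "i4 \<noteq> i0" using no_four[OF d] i by auto
  ultimately have d5: "distinct [i0, i1, i2, i3, i4]" using d by auto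
  have "g i4 \<in> {i0, i1, i2, i3, i4}" using card[OF d5] by auto
  moreover have "g i4 \<noteq> i4" "g i4 \<noteq> i3" "g i4 \<noteq> i2" using g1[of i4] g2[of i3] g3[of i2] by (auto simp: i)
  moreover have "g i4 \<noteq> i1" using no_four[of i1 i2 i3 i4] d5 i by auto
  ultimately have "g i4 = i0" by blast
  then show False
    using acyclic_columnless.no_five_cycle_varies[OF acyclic_frame[OF d5], of z]
      g[of i0] g[of i1] g[of i2] g[of i3] g[of i4] by (simp flip: i)
qed


theorem theorem7:
  fixes T :: "(real ^ 5) set"
  assumes "cube_tiling T"
  shows "\<exists>(s :: real ^ 5) (i :: 5). \<forall>k :: int. s + of_int k *\<^sub>R axis i 1 \<in> T"
proof -
  obtain f :: "5 \<Rightarrow> (5 \<Rightarrow> int) \<Rightarrow> real"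
    where f: "keller_labelling f" "\<And>z. (\<chi> i. of_int (z i) - f i z) \<in> T"
    using labelling_of_cube_tiling[OF assms] by blast
  obtain z i where "\<And>j k. f j (z(i := k)) = f j z"
    using constant_line_exists[OF f(1)] by auto
  then show ?thesis by (rule column_of_constant_line[OF f(2)])
qed

end
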